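(* Assume that the function $F$ is strictly convex on $\mathbb R^n_+$. Then the sequence $\{\mathbf x^{(k)}\}$ generated by Algorithm ACQUIRE (described in the context) applied to the problem of minimizing $F$ over $\mathcal S$ converges to a point $\overline{\mathbf x}\in\mathcal S$ such that $\nabla_{\mathcal S}F(\overline{\mathbf x})=\mathbf 0$.
   Context: Data. $m,n\in\mathbb N$ with $n=rs$; $A=(a_{ij})\in\mathbb R^{m\times n}$ with $a_{ij}\ge 0$ for all $i,j$ and $\sum_{i=1}^m a_{ij}=1$ for all $j$; $\mathbf b\in\mathbb R^m$ with $\mathbf b>0$ componentwise; $\mathbf y\in\mathbb R^m$ with $\mathbf y\ge 0$; $\lambda>0$, $\mu>0$; $\mathcal S$ is a nonempty, closed, convex subset of $\mathbb R^n_+=\{\mathbf x\in\mathbb R^n:\mathbf x\ge 0\}$. $\|\cdot\|$ is the Euclidean norm. Objective. Define $$D_{KL}(\mathbf x)=\sum_{j=1}^m\Big(y_j\ln\frac{y_j}{(A\mathbf x+\mathbf b)_j}+(A\mathbf x+\mathbf b)_j-y_j\Big),$$ where the term $y_j\ln(y_j/(A\mathbf x+\mathbf b)_j)$ is $0$ if $y_j=0$; this formula is used on the open set $\{\mathbf x: A\mathbf x+\mathbf b>0\}\supset\mathbb R^n_+$, so gradients and Hessians make sense at points of $\mathbb R^n_+$. A vector $\mathbf x\in\mathbb R^n$ is identified with an image $X\in\mathbb R^{r\times s}$ by $x_i=X_{k,l}$, $i=(l-1)r+k$, and $D_i\in\mathbb R^{2\times n}$ is the fixed matrix with $D_i\mathbf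 x=(X_{k+1,l}-X_{k,l},\;X_{k,l+1}-X_{k,l})^T$, where out-of-range entries of $X$ are given by fixed linear homogeneous boundary conditions (e.g. periodic). Let $$TV_\mu(\mathbf x)=\sum_{i=1}^n\phi_\mu(\|D_i\mathbf x\|),\qquad \phi_\mu(z)=\begin{cases}|z| & |z|>\mu,\\ \tfrac12\big(\tfrac{z^2}{\mu}+\mu\big)&\text{otherwise},\end{cases}$$ and $F(\mathbf x)=D_{KL}(\mathbf x)+\lambda\,TV_\mu(\mathbf x)$. Projected gradient. For a function $f$ continuously differentiable on an open set containing $\mathcal S$ and $\mathbf x\in\mathcal S$, $\nabla_{\mathcal S}f(\mathbf x)=\arg\min\{\|\mathbf v+\nabla f(\mathbf x)\| : \mathbf v\in T_{\mathcal S}(\mathbf x)\}$, i.e. the orthogonal projection of $-\nabla f(\mathbf x)$ onto the tangent cone $T_{\mathcal S}(\mathbf x)$ to $\mathcal S$ at $\mathbf x$ (the closure of $\{t(\mathbf z-\mathbf x):\mathbf z\in\mathcal S,\ t\ge0\}$). Quadratic models. Fix $\gamma>0$ (the choice $\gamma=0$ is also allowed when $\mathbf y>0$, $A$ has trivial nullspace and $\mathcal S$ is bounded). Given $\mathbf x^{(k)}\in\mathcal S$, put $$D^{(k)}_{KL}(\mathbf x)=D_{KL}(\mathbf x^{(k)})+(\mathbf x-\mathbf x^{(k)})^T\nabla D_{KL}(\mathbf x^{(k)})+\tfrac12(\mathbf x-\mathbf x^{(k)})^T\big(\nabla^2D_{KL}(\mathbf x^{(k)})+\gamma I\big)(\mathbf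 x-\mathbf x^{(k)}),$$ $$TV^{(k)}_\mu(\mathbf x)=\tfrac12\sum_{i=1}^n w^{(k)}_i\|D_i\mathbf x\|^2+\tfrac12TV_\mu(\mathbf x^{(k)}),\qquad w^{(k)}_i=\begin{cases}\|D_i\mathbf x^{(k)}\|^{-1}&\|D_i\mathbf x^{(k)}\|>\mu,\\ \mu^{-1}&\text{otherwise},\end{cases}$$ and $F_k=D^{(k)}_{KL}+\lambda\,TV^{(k)}_\mu$. Let $\overline{\mathbf x}^{(k)}$ be the unique minimizer of $F_k$ over $\mathcal S$. Algorithm ACQUIRE. Choose $\mathbf x^{(0)}\in\mathcal S$, $\eta\in(0,1)$, $\delta\in(0,1)$ and $\{\varepsilon_k\}$ with $\varepsilon_k>0$, $\lim_{k\to\infty}\varepsilon_k=0$. For $k=0,1,2,\dots$: (1) compute any $\widehat{\mathbf x}^{(k)}\in\mathcal S$ with $\|\widehat{\mathbf x}^{(k)}-\overline{\mathbf x}^{(k)}\|\le\varepsilon_k$ and $F_k(\widehat{\mathbf x}^{(k)})\le F_k(\mathbf x^{(k)})$; (2) set $\mathbf d^{(k)}=\widehat{\mathbf x}^{(k)}-\mathbf x^{(k)}$ and let $\alpha_k$ be the first element of $1,\delta,\delta^2,\dots$ such that $F(\mathbf x^{(k)}+\alpha_k\mathbf d^{(k)})\le F(\mathbf x^{(k)})+\eta\,\alpha_k\nabla F(\mathbf x^{(k)})^T\mathbf d^{(k)}$; (3) set $\mathbf x^{(k+1)}=\mathbf x^{(k)}+\alpha_k\mathbf d^{(k)}$. 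*)

theory Defs
  imports "HOL-Analysis.Analysis"
begin

definition nonneg_orthant :: "(real ^ 'n) set" where
  "nonneg_orthant = {x. \<forall>i. 0 \<le> x $ i}"

definition strictly_convex_on :: "'a::real_vector set \<Rightarrow> ('a \<Rightarrow> real) \<Rightarrow> bool" where
  "strictly_convex_on C f \<longleftrightarrow> convex C \<and>
     (\<forall>x\<in>C. \<forall>z\<in>C. x \<noteq> z \<longrightarrow>
        (\<forall>t\<in>{0<..<1}. f ((1 - t) *\<^sub>R x + t *\<^sub>R z) < (1 - t) * f x + t * f z))"

definition gradient :: "('a::real_inner \<Rightarrow> real) \<Rightarrow> 'a \<Rightarrow> 'a" where
  "gradient f x = (THE g. GDERIV f x :> g)"

lemma gradient_eq:
  assumes "GDERIV f x :> g"
  shows "gradient f x = g"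
  unfolding gradient_def
proof (rule the_equality)
  show "GDERIV f x :> g" by (rule assms)
next
  fix g' assume "GDERIV f x :> g'"
  then have "(\<lambda>h. h \<bullet> g') = (\<lambda>h. h \<bullet> g)"
    using assms unfolding gderiv_def by (rule has_derivative_unique)
  then have "(g' - g) \<bullet> g' = (g' - g) \<bullet> g"
    by (rule fun_cong)
  then have "(g' - g) \<bullet> (g' - g) = 0"
    by (simp only: inner_diff_right)
  then show "g' = g" by simp
qed

definition hessian :: "(real ^ 'n \<Rightarrow> real) \<Rightarrow> real ^ 'n \<Rightarrow> real ^ 'n ^ 'n" where
  "hessian f x = jacobian (gradient f) (at x)"

definition tangent_cone :: "'a::real_normed_vector set \<Rightarrow> 'a \<Rightarrow> 'a set" where
  "tangent_cone S x = closure {t *\<^sub>R (z - x) | t z. z \<in> S \<and> 0 \<le> t}"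

definition projected_gradient :: "'a::real_inner set \<Rightarrow> ('a \<Rightarrow> real) \<Rightarrow> 'a \<Rightarrow> 'a" where
  "projected_gradient S f x = arg_min_on (\<lambda>v. norm (v + gradient f x)) (tangent_cone S x)"

(* Intended for arguments with A x + b > 0. Elsewhere the value is irrelevant: this set is open and
   contains the nonnegative orthant, where alone function values and derivatives are used. *)
definition KL :: "real ^ 'n ^ 'm \<Rightarrow> real ^ 'm \<Rightarrow> real ^ 'm \<Rightarrow> real ^ 'n \<Rightarrow> real" where
  "KL A b y x =
     (\<Sum>j\<in>UNIV. (if y $ j = 0 then 0 else y $ j * ln (y $ j / (A *v x + b) $ j))
                + (A *v x + b) $ j - y $ j)"

definition huber :: "real \<Rightarrow> real \<Rightarrow> real" where
  "huber \<mu> z = (if \<bar>z\<bar> > \<mu> then \<bar>z\<bar> else (z\<^sup>2 / \<mu> + \<mu>) / 2)"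

definition TV :: "(nat \<Rightarrow> real ^ 'n ^ 2) \<Rightarrow> real \<Rightarrow> real ^ 'n \<Rightarrow> real" where
  "TV D \<mu> x = (\<Sum>i=1..CARD('n). huber \<mu> (norm (D i *v x)))"

definition objective ::
  "real ^ 'n ^ 'm \<Rightarrow> real ^ 'm \<Rightarrow> real ^ 'm \<Rightarrow> (nat \<Rightarrow> real ^ 'n ^ 2) \<Rightarrow> real \<Rightarrow> real
    \<Rightarrow> real ^ 'n \<Rightarrow> real" where
  "objective A b y D lam \<mu> x = KL A b y x + lam * TV D \<mu> x"

(* In the following models the argument c is the current iterate, the centre of the model. *)

definition KL_model ::
  "real ^ 'n ^ 'm \<Rightarrow> real ^ 'm \<Rightarrow> real ^ 'm \<Rightarrow> real \<Rightarrow> real ^ 'n \<Rightarrow> real ^ 'n \<Rightarrow> real" where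
  "KL_model A b y \<gamma> c x =
     KL A b y c + (x - c) \<bullet> gradient (KL A b y) c
     + 1/2 * ((x - c) \<bullet> ((hessian (KL A b y) c + \<gamma> *\<^sub>R mat 1) *v (x - c)))"

definition TV_weight :: "(nat \<Rightarrow> real ^ 'n ^ 2) \<Rightarrow> real \<Rightarrow> real ^ 'n \<Rightarrow> nat \<Rightarrow> real" where
  "TV_weight D \<mu> c i =
     (if norm (D i *v c) > \<mu> then inverse (norm (D i *v c)) else inverse \<mu>)"

definition TV_model ::
  "(nat \<Rightarrow> real ^ 'n ^ 2) \<Rightarrow> real \<Rightarrow> real ^ 'n \<Rightarrow> real ^ 'n \<Rightarrow> real" where
  "TV_model D \<mu> c x =
     1/2 * (\<Sum>i=1..CARD('n). TV_weight D \<mu> c i * (norm (D i *v x))\<^sup>2) + 1/2 * TV D \<mu> c"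

definition quadratic_model ::
  "real ^ 'n ^ 'm \<Rightarrow> real ^ 'm \<Rightarrow> real ^ 'm \<Rightarrow> (nat \<Rightarrow> real ^ 'n ^ 2) \<Rightarrow> real \<Rightarrow> real \<Rightarrow> real
    \<Rightarrow> real ^ 'n \<Rightarrow> real ^ 'n \<Rightarrow> real" where
  "quadratic_model A b y D lam \<mu> \<gamma> c x = KL_model A b y \<gamma> c x + lam * TV_model D \<mu> c x"

definition armijo ::
  "('a::real_inner \<Rightarrow> real) \<Rightarrow> real \<Rightarrow> 'a \<Rightarrow> 'a \<Rightarrow> real \<Rightarrow> bool" where
  "armijo f \<eta> x d \<alpha> \<longleftrightarrow> f (x + \<alpha> *\<^sub>R d) \<le> f x + \<eta> * \<alpha> * (gradient f x \<bullet> d)"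

(* M c is the model of f at c. The minimizer of M (x k) over S is written with arg_min_on and the
   step length with LEAST, so that neither the existence of the minimizer nor the termination of
   the line search is part of the hypothesis. *)
definition acquire_sequence ::
  "('a::real_inner \<Rightarrow> real) \<Rightarrow> ('a \<Rightarrow> 'a \<Rightarrow> real) \<Rightarrow> 'a set \<Rightarrow> real \<Rightarrow> real \<Rightarrow> (nat \<Rightarrow> real)
    \<Rightarrow> (nat \<Rightarrow> 'a) \<Rightarrow> bool" where
  "acquire_sequence f M S \<eta> \<delta> \<epsilon> x \<longleftrightarrow>
     x 0 \<in> S \<and>
     (\<exists>xhat d \<alpha>. \<forall>k.
        xhat k \<in> S \<and>
        norm (xhat k - arg_min_on (M (x k)) S) \<le> \<epsilon> k \<and>
        M (x k) (xhat k) \<le> M (x k) (x k) \<and>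
        d k = xhat k - x k \<and>
        \<alpha> k = \<delta> ^ (LEAST j. armijo f \<eta> (x k) (d k) (\<delta> ^ j)) \<and>
        x (Suc k) = x k + \<alpha> k *\<^sub>R d k)"

(* The i-th coordinate of x, counted from 1, is x $ \<iota> i. X x is the r-by-s image of x, extended
   beyond its range by arbitrary homogeneous linear boundary conditions; only the entries with
   k = r + 1 or l = s + 1 matter. *)
definition extended_image ::
  "nat \<Rightarrow> nat \<Rightarrow> (nat \<Rightarrow> 'n) \<Rightarrow> (real ^ 'n \<Rightarrow> nat \<Rightarrow> nat \<Rightarrow> real) \<Rightarrow> bool" where
  "extended_image r s \<iota> X \<longleftrightarrow>
     (\<forall>k\<in>{1..r}. \<forall>l\<in>{1..s}. \<forall>x. X x k l = x $ \<iota> ((l - 1) * r + k)) \<and>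
     (\<forall>k l. linear (\<lambda>x. X x k l))"

definition difference_matrices ::
  "nat \<Rightarrow> nat \<Rightarrow> (real ^ 'n \<Rightarrow> nat \<Rightarrow> nat \<Rightarrow> real) \<Rightarrow> (nat \<Rightarrow> real ^ 'n ^ 2) \<Rightarrow> bool" where
  "difference_matrices r s X D \<longleftrightarrow>
     (\<forall>k\<in>{1..r}. \<forall>l\<in>{1..s}. \<forall>x.
        D ((l - 1) * r + k) *v x = vector [X x (k + 1) l - X x k l, X x k (l + 1) - X x k l])"

end

theory Submission
  imports Defs
begin

text \<open>
  On the nonnegative orthant, \<^term>\<open>KL A b y\<close> and \<^term>\<open>TV D \<mu>\<close> lie above
  their linearizations and below the linearizations plus a fixed multiple of the squared distance; so do the models, which
  moreover lie above the linearization plus a fixed positive multiple of the squared distance.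
  Hence the search directions are descent directions, the step lengths stay away from 0, and the
  search directions tend to 0. If \<open>c\<close> is an iterate and \<open>z \<in> S\<close>, the model minimizer is no worse than
  \<open>c + t (z - c)\<close>; in the limit along a subsequence, and then \<open>t \<rightarrow> 0\<close>, this
  makes every limit point critical. The objective is coercive since the columns of \<open>A\<close> sum to 1,
  and strict convexity leaves only one critical point.
\<close>

section \<open>Convergence for models with two-sided quadratic bounds\<close>

text \<open>The closed half-space of all v with g . v nonnegative contains S - p, hence the whole
  tangent cone. There every nonzero v makes norm (v + g) larger than norm g, so 0 is the only
  minimizer; uniqueness is what pins down the choice made by \<open>arg_min_on\<close>.\<close>

lemma projected_gradient_eq_0:
  assumes grad: "GDERIV f p :> g" and p: "p \<in> S"
    and crit: "\<And>z. z \<in> S \<Longrightarrow> 0 \<le> g \<bullet> (z - p)"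
  shows "projected_gradient S f p = 0"
proof -
  have "closed {v. 0 \<le> g \<bullet> v}"
    using closed_halfspace_ge[of 0 g] by (simp add: inner_commute)
  then have cone: "tangent_cone S p \<subseteq> {v. 0 \<le> g \<bullet> v}"
    unfolding tangent_cone_def using crit by (intro closure_minimal) auto
  have "0 *\<^sub>R (p - p) \<in> {t *\<^sub>R (z - p) |t z. z \<in> S \<and> 0 \<le> t}"
    using p by blast
  then have zero: "0 \<in> tangent_cone S p"
    unfolding tangent_cone_def using closure_subset by fastforce
  have less: "norm g < norm (v + g)" if "v \<in> tangent_cone S p" "v \<noteq> 0" for v
  proof -
    have "(norm (v + g))\<^sup>2 = (norm v)\<^sup>2 + 2 * (g \<bullet> v) + (norm g)\<^sup>2"
      by (simp add: power2_norm_eq_inner inner_add_left inner_add_right inner_commute)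
    moreover have "0 < (norm v)\<^sup>2" "0 \<le> g \<bullet> v"
      using that cone by auto
    ultimately have "(norm g)\<^sup>2 < (norm (v + g))\<^sup>2" by linarith
    then show ?thesis by (rule power_less_imp_less_base) simp
  qed
  show ?thesis
    unfolding projected_gradient_def arg_min_on_def gradient_eq[OF grad]
  proof (rule arg_minI[where x = 0])
    fix v assume "v \<in> tangent_cone S p"
    then show "\<not> norm (v + g) < norm (0 + g)"
      using less[of v] by (cases "v = 0") auto
  next
    fix v assume v: "v \<in> tangent_cone S p"
      and "\<forall>w. w \<in> tangent_cone S p \<longrightarrow> \<not> norm (w + g) < norm (v + g)"
    then show "v = 0"
      using less[OF v] zero by force
  qed (rule zero)
qed

text \<open>\<open>arg_min_on\<close> is a choice operator, so it carries information only once a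
  minimizer exists. One exists on the compact sublevel set of c, and points of S outside that set
  have larger values.\<close>

lemma arg_min_on_coercive:
  fixes f :: "'a::heine_borel \<Rightarrow> real"
  assumes "closed S" and c: "c \<in> S" and cont: "continuous_on S f"
    and bdd: "bounded {z \<in> S. f z \<le> f c}"
  shows "arg_min_on f S \<in> S" and "z \<in> S \<Longrightarrow> f (arg_min_on f S) \<le> f z"
proof -
  let ?T = "{z \<in> S. f z \<le> f c}"
  have "closed ?T"
    using \<open>closed S\<close> by (intro continuous_on_closed_Collect_le cont continuous_on_const)
  with bdd have "compact ?T"
    by (simp add: compact_eq_bounded_closed)
  moreover have "?T \<noteq> {}" using c by auto
  ultimately obtain m where m: "m \<in> ?T" "\<And>z. z \<in> ?T \<Longrightarrow> f m \<le> f z"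
    using continuous_attains_inf[of ?T f] continuous_on_subset[OF cont, of ?T] by auto
  then have min: "f m \<le> f z" if "z \<in> S" for z
    using that by (cases "f z \<le> f c") force+
  have "is_arg_min f (\<lambda>z. z \<in> S) m"
    using m(1) min by (auto simp: is_arg_min_linorder)
  then have "is_arg_min f (\<lambda>z. z \<in> S) (arg_min_on f S)"
    unfolding arg_min_on_def arg_min_def by (rule someI)
  then show "arg_min_on f S \<in> S" "z \<in> S \<Longrightarrow> f (arg_min_on f S) \<le> f z"
    by (auto simp: is_arg_min_linorder)
qed

text \<open>The remainder lies between 0 and a multiple of the squared increment, so it is of
  smaller order. This yields the gradient of the smoothed total variation directly from its two
  quadratic bounds.\<close>

lemma GDERIV_quadratic_sandwich:
  fixes f :: "'a::real_inner \<Rightarrow> real"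
  assumes lower: "\<And>z. f x + g \<bullet> (z - x) \<le> f z"
    and upper: "\<And>z. f z \<le> f x + g \<bullet> (z - x) + C * (norm (z - x))\<^sup>2"
  shows "GDERIV f x :> g"
  unfolding gderiv_def has_derivative_at
proof
  show "bounded_linear (\<lambda>h. h \<bullet> g)"
    by (rule bounded_linear_inner_left)
  have "norm (norm (f (x + h) - f x - h \<bullet> g) / norm h) \<le> norm h * \<bar>C\<bar>" for h
  proof (cases "h = 0")
    case False
    have "0 \<le> f (x + h) - f x - h \<bullet> g" "f (x + h) - f x - h \<bullet> g \<le> C * (norm h)\<^sup>2"
      using lower[of "x + h"] upper[of "x + h"] by (auto simp: inner_commute)
    moreover have "C * (norm h)\<^sup>2 \<le> \<bar>C\<bar> * (norm h)\<^sup>2"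
      by (intro mult_right_mono) auto
    ultimately have "\<bar>f (x + h) - f x - h \<bullet> g\<bar> \<le> (norm h * \<bar>C\<bar>) * norm h"
      by (simp add: power2_eq_square mult_ac)
    then show ?thesis
      using False by (simp add: pos_divide_le_eq)
  qed simp
  then have "\<forall>\<^sub>F h in at 0. norm (norm (f (x + h) - f x - h \<bullet> g) / norm h) \<le> norm h * \<bar>C\<bar>"
    by simp
  then show "(\<lambda>h. norm (f (x + h) - f x - h \<bullet> g) / norm h) \<midarrow>0\<rightarrow> 0"
    by (rule tendsto_0_le[OF tendsto_ident_at])
qed

text \<open>If some subsequence stayed away from l, compactness would give a further subsequence
  with a limit, and by \<open>uniq\<close> that limit is l.\<close>

lemma unique_limit_point_imp_LIMSEQ:
  fixes x :: "nat \<Rightarrow> 'a::metric_space"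
  assumes K: "compact K" "\<And>k. x k \<in> K"
    and uniq: "\<And>r l'. strict_mono r \<Longrightarrow> (x \<circ> r) \<longlonglongrightarrow> l' \<Longrightarrow> l' = l"
  shows "x \<longlonglongrightarrow> l"
proof (rule ccontr)
  assume "\<not> x \<longlonglongrightarrow> l"
  then obtain e where e: "0 < e" "\<not> (\<forall>\<^sub>F k in sequentially. dist (x k) l < e)"
    by (auto simp: tendsto_iff)
  obtain r :: "nat \<Rightarrow> nat" where r: "strict_mono r" "\<And>n. \<not> dist (x (r n)) l < e"
    using not_eventually_sequentiallyD[OF e(2)] by auto
  obtain l' r' where r': "strict_mono (r' :: nat \<Rightarrow> nat)" "((x \<circ> r) \<circ> r') \<longlonglongrightarrow> l'"
    using K by (auto intro: seq_compactE[of K "x \<circ> r"] simp: compact_imp_seq_compact)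
  have "l' = l"
    using uniq[of "r \<circ> r'" l'] r r' by (simp add: strict_mono_o o_assoc)
  then have "\<forall>\<^sub>F n in sequentially. dist (((x \<circ> r) \<circ> r') n) l < e"
    using r'(2) e(1) by (auto simp: tendsto_iff)
  then show False using r(2) by (auto simp: eventually_sequentially)
qed

text \<open>For 0 < a \<le> min 1 \<tau> the quadratic error L a^2 |d|^2 is absorbed by the slack (1
  - \<eta>) a (- g . d) of the Armijo test. All such a are accepted, so backtracking passes below
  \<tau> by at most one factor \<delta>.\<close>

lemma armijo_step_bound:
  fixes f :: "'a::real_inner \<Rightarrow> real"
  assumes S: "convex S" "x \<in> S" "x + d \<in> S" and grad: "gradient f x = g"
    and upper: "\<And>z. z \<in> S \<Longrightarrow> f z \<le> f x + g \<bullet> (z - x) + L * (norm (z - x))\<^sup>2"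
    and descent: "g \<bullet> d \<le> - (\<sigma> * (norm d)\<^sup>2)"
    and pos: "0 < L" "0 < \<sigma>" and eta: "\<eta> < 1" and delta: "\<delta> \<in> {0<..<1}"
    and alpha: "\<alpha> = \<delta> ^ (LEAST j. armijo f \<eta> x d (\<delta> ^ j))"
  shows "armijo f \<eta> x d \<alpha>" and "min 1 (\<delta> * ((1 - \<eta>) * \<sigma> / L)) \<le> \<alpha>"
proof -
  let ?\<tau> = "(1 - \<eta>) * \<sigma> / L"
  have tau: "0 < ?\<tau>" using pos eta by simp
  have small: "armijo f \<eta> x d a" if a: "0 < a" "a \<le> 1" "a \<le> ?\<tau>" for a
  proof -
    have "x + a *\<^sub>R d = (1 - a) *\<^sub>R x + a *\<^sub>R (x + d)"
      by (simp add: algebra_simps)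
    then have "x + a *\<^sub>R d \<in> S"
      using convexD_alt[OF S] a by simp
    then have "f (x + a *\<^sub>R d) \<le> f x + a * (g \<bullet> d) + L * (a * a * (norm d)\<^sup>2)"
      using upper[of "x + a *\<^sub>R d"] a(1) by (simp add: power2_eq_square mult_ac)
    moreover have "L * (a * a * (norm d)\<^sup>2) \<le> (1 - \<eta>) * a * - (g \<bullet> d)"
    proof -
      have "(L * a) * (a * (norm d)\<^sup>2) \<le> ((1 - \<eta>) * \<sigma>) * (a * (norm d)\<^sup>2)"
        using a pos by (intro mult_right_mono) (simp_all add: field_simps)
      also have "\<dots> = ((1 - \<eta>) * a) * (\<sigma> * (norm d)\<^sup>2)" by (simp add: mult_ac)
      also have "\<dots> \<le> ((1 - \<eta>) * a) * - (g \<bullet> d)"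
        using a eta descent by (intro mult_left_mono) auto
      finally show ?thesis by (simp add: mult_ac)
    qed
    ultimately show ?thesis
      unfolding armijo_def grad by (simp add: algebra_simps)
  qed
  \<comment> \<open>Some trial step is short enough to be accepted, so \<open>LEAST\<close> ranges
    over a nonempty set: the line search terminates.\<close>
  obtain n where "\<delta> ^ n < ?\<tau>"
    using real_arch_pow_inv[OF tau] delta by auto
  then have "armijo f \<eta> x d (\<delta> ^ n)"
    using small[of "\<delta> ^ n"] delta by (simp add: power_le_one)
  then show "armijo f \<eta> x d \<alpha>"
    unfolding alpha by (rule LeastI)
  show "min 1 (\<delta> * ?\<tau>) \<le> \<alpha>"
  proof (cases "LEAST j. armijo f \<eta> x d (\<delta> ^ j)")
    case (Suc m)
    \<comment> \<open>The trial step just before the accepted one was rejected, so it cannot lie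
      below \<tau>.\<close>
    then have "\<not> armijo f \<eta> x d (\<delta> ^ m)"
      using not_less_Least[of m "\<lambda>j. armijo f \<eta> x d (\<delta> ^ j)"] by simp
    then have "?\<tau> \<le> \<delta> ^ m"
      using small[of "\<delta> ^ m"] delta by (force simp: power_le_one)
    then have "\<delta> * ?\<tau> \<le> \<delta> * \<delta> ^ m" using delta by (intro mult_left_mono) auto
    then show ?thesis using Suc alpha by simp
  qed (simp add: alpha)
qed


text \<open>The first-order inequality turns both critical points into minimizers over S, whereas
  strict convexity would put the value at their midpoint below the mean of the two minima.\<close>

lemma critical_point_unique:
  assumes S: "S \<subseteq> C" "convex S" and strict: "strictly_convex_on C f"
    and lower: "\<And>x z. x \<in> S \<Longrightarrow> z \<in> S \<Longrightarrow> f x + g x \<bullet> (z - x) \<le> f z"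
    and p: "p \<in> S" "\<And>z. z \<in> S \<Longrightarrow> 0 \<le> g p \<bullet> (z - p)"
    and q: "q \<in> S" "\<And>z. z \<in> S \<Longrightarrow> 0 \<le> g q \<bullet> (z - q)"
  shows "p = q"
proof (rule ccontr)
  assume "p \<noteq> q"
  let ?m = "(1 - 1/2) *\<^sub>R p + (1/2) *\<^sub>R q"
  have "\<forall>t\<in>{0<..<1}. f ((1 - t) *\<^sub>R p + t *\<^sub>R q) < (1 - t) * f p + t * f q"
    using strict \<open>p \<noteq> q\<close> p(1) q(1) S(1) unfolding strictly_convex_on_def by blast
  then have "f ?m < (1 - 1/2) * f p + (1/2) * f q"
    by (rule bspec) simp
  moreover have m: "?m \<in> S"
    using convexD_alt[OF S(2) p(1) q(1), of "1/2"] by simp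
  moreover have "f p \<le> f ?m" "f q \<le> f ?m"
    using lower[OF p(1) m] p(2)[OF m] lower[OF q(1) m] q(2)[OF m] by linarith+
  ultimately show False by (simp add: field_simps)
qed

text \<open>In the sublevel set the linear term must compensate the quadratic one, and
  Cauchy-Schwarz then confines z to a ball around c.\<close>

lemma quadratic_growth_bounded:
  fixes f :: "'a::real_inner \<Rightarrow> real"
  assumes "0 < \<sigma>" and lower: "\<And>z. z \<in> S \<Longrightarrow> f c + g \<bullet> (z - c) + \<sigma> * (norm (z - c))\<^sup>2 \<le> f z"
  shows "bounded {z \<in> S. f z \<le> f c}"
proof (rule bounded_subset[OF bounded_cball])
  show "{z \<in> S. f z \<le> f c} \<subseteq> cball c (norm g / \<sigma>)"
  proof
    fix z assume z: "z \<in> {z \<in> S. f z \<le> f c}"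
    have "\<sigma> * (norm (z - c))\<^sup>2 \<le> - (g \<bullet> (z - c))"
      using z lower[of z] by simp
    also have "\<dots> \<le> norm g * norm (z - c)"
      using norm_cauchy_schwarz[of "- g" "z - c"] by simp
    finally have "\<sigma> * norm (z - c) \<le> norm g"
      by (cases "z = c") (auto simp: power2_eq_square)
    then show "z \<in> cball c (norm g / \<sigma>)"
      using \<open>0 < \<sigma>\<close> by (simp add: dist_norm norm_minus_commute field_simps)
  qed
qed

text \<open>The model value at its centre need not be the value of the objective: the smoothed total
  variation model differs there from the total variation by a constant.\<close>

lemma acquire_sequence_converges:
  fixes f :: "'a::euclidean_space \<Rightarrow> real"
  assumes S: "closed S" "convex S" "S \<subseteq> C"
    and grad: "\<And>x. x \<in> S \<Longrightarrow> GDERIV f x :> g x"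
    and lower: "\<And>x z. x \<in> S \<Longrightarrow> z \<in> S \<Longrightarrow> f x + g x \<bullet> (z - x) \<le> f z"
    and upper: "\<And>x z. x \<in> S \<Longrightarrow> z \<in> S \<Longrightarrow>
      f z \<le> f x + g x \<bullet> (z - x) + L * (norm (z - x))\<^sup>2"
    and cont: "continuous_on S g"
    and strict: "strictly_convex_on C f"
    and coercive: "\<And>c. bounded {x \<in> S. f x \<le> c}"
    and M_lower: "\<And>c z. c \<in> S \<Longrightarrow> z \<in> S \<Longrightarrow>
      M c c + g c \<bullet> (z - c) + \<sigma> * (norm (z - c))\<^sup>2 \<le> M c z"
    and M_upper: "\<And>c z. c \<in> S \<Longrightarrow> z \<in> S \<Longrightarrow>
      M c z \<le> M c c + g c \<bullet> (z - c) + \<Lambda> * (norm (z - c))\<^sup>2"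
    and M_cont: "\<And>c. c \<in> S \<Longrightarrow> continuous_on S (M c)"
    and pos: "0 < L" "0 < \<sigma>" and eta: "\<eta> \<in> {0<..<1}" and delta: "\<delta> \<in> {0<..<1}"
    and eps: "\<epsilon> \<longlonglongrightarrow> 0"
    and seq: "acquire_sequence f M S \<eta> \<delta> \<epsilon> x"
  shows "\<exists>p\<in>S. x \<longlonglongrightarrow> p \<and> projected_gradient S f p = 0"
proof -
  obtain xh d \<alpha> where run: "\<forall>k.
      xh k \<in> S \<and> norm (xh k - arg_min_on (M (x k)) S) \<le> \<epsilon> k \<and>
      M (x k) (xh k) \<le> M (x k) (x k) \<and> d k = xh k - x k \<and>
      \<alpha> k = \<delta> ^ (LEAST j. armijo f \<eta> (x k) (d k) (\<delta> ^ j)) \<and>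
      x (Suc k) = x k + \<alpha> k *\<^sub>R d k"
    using seq unfolding acquire_sequence_def by (elim conjE exE)
  have x0: "x 0 \<in> S"
    using seq unfolding acquire_sequence_def by (rule conjunct1)
  have xh: "xh k \<in> S"
    and near: "norm (xh k - arg_min_on (M (x k)) S) \<le> \<epsilon> k"
    and dec: "M (x k) (xh k) \<le> M (x k) (x k)"
    and d: "d k = xh k - x k"
    and alpha: "\<alpha> k = \<delta> ^ (LEAST j. armijo f \<eta> (x k) (d k) (\<delta> ^ j))"
    and step: "x (Suc k) = x k + \<alpha> k *\<^sub>R d k" for k
    by (insert spec[OF run, of k], (elim conjE, assumption)+)
  have alpha01: "0 < \<alpha> k" "\<alpha> k \<le> 1" for k
    using delta by (auto simp: alpha power_le_one)
  have xS: "x k \<in> S" for k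
  proof (induction k)
    case (Suc k)
    have "x (Suc k) = (1 - \<alpha> k) *\<^sub>R x k + \<alpha> k *\<^sub>R xh k"
      by (simp add: step d algebra_simps)
    then show ?case
      using convexD_alt[OF S(2) Suc xh[of k], of "\<alpha> k"] alpha01[of k] by simp
  qed (rule x0)
  \<comment> \<open>The exact model minimizer, which \<open>xh k\<close> approximates.\<close>
  define m where "m k = arg_min_on (M (x k)) S" for k
  have m: "m k \<in> S" "z \<in> S \<Longrightarrow> M (x k) (m k) \<le> M (x k) z" for k z
  proof -
    have "bounded {z \<in> S. M (x k) z \<le> M (x k) (x k)}"
      by (rule quadratic_growth_bounded[OF pos(2) M_lower[OF xS]])
    note min = arg_min_on_coercive[OF S(1) xS M_cont[OF xS] this]
    show "m k \<in> S" "z \<in> S \<Longrightarrow> M (x k) (m k) \<le> M (x k) z"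
      unfolding m_def by (rule min(1)) (rule min(2))
  qed
  \<comment> \<open>The model does not increase from \<open>x k\<close> to \<open>xh k\<close>, so
    its value at the centre cancels from the lower bound.\<close>
  have descent: "g (x k) \<bullet> d k \<le> - (\<sigma> * (norm (d k))\<^sup>2)" for k
    using M_lower[OF xS xh, of k k] dec[of k] by (simp add: d)

  \<comment> \<open>A lower bound for all step lengths at once, independent of k.\<close>
  define a where "a = min 1 (\<delta> * ((1 - \<eta>) * \<sigma> / L))"
  have a: "0 < a" using pos eta delta by (simp add: a_def)
  have arm: "armijo f \<eta> (x k) (d k) (\<alpha> k)" and a_le: "a \<le> \<alpha> k" for k
    unfolding a_def
    using armijo_step_bound[where f = f and x = "x k" and d = "d k" and \<alpha> = "\<alpha> k",
        OF S(2) xS _ gradient_eq[OF grad[OF xS]] upper[OF xS] descent pos _ delta alpha] xh[of k] eta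
    by (simp_all add: d)
  \<comment> \<open>The guaranteed decrease is a fixed multiple of the squared length of
    \<open>d k\<close>; once the values of f are known to converge, this forces \<open>d k\<close>
    to 0.\<close>
  have decrease: "\<eta> * (a * (\<sigma> * (norm (d k))\<^sup>2)) \<le> f (x k) - f (x (Suc k))" for k
  proof -
    have "a * (\<sigma> * (norm (d k))\<^sup>2) \<le> \<alpha> k * - (g (x k) \<bullet> d k)"
      using a_le[of k] descent[of k] pos a by (intro mult_mono) auto
    then have "\<eta> * (a * (\<sigma> * (norm (d k))\<^sup>2)) \<le> \<eta> * (\<alpha> k * - (g (x k) \<bullet> d k))"
      using eta by (intro mult_left_mono) auto
    also have "\<dots> \<le> f (x k) - f (x (Suc k))"
      using arm[of k] by (simp add: armijo_def gradient_eq[OF grad[OF xS]] step mult_ac)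
    finally show ?thesis .
  qed
  have "decseq (\<lambda>k. f (x k))"
  proof (rule decseq_SucI)
    fix k
    have "0 \<le> \<eta> * (a * (\<sigma> * (norm (d k))\<^sup>2))" using eta a pos by simp
    then show "f (x (Suc k)) \<le> f (x k)" using decrease[of k] by linarith
  qed
  then have fle: "f (x k) \<le> f (x 0)" for k by (simp add: decseq_def)
  define K where "K = {z \<in> S. f z \<le> f (x 0)}"
  have xK: "x k \<in> K" for k using xS fle by (simp add: K_def)
  have f_cont: "continuous_on S f"
    using grad unfolding gderiv_def
    by (meson continuous_at_imp_continuous_on has_derivative_continuous)
  have "closed K"
    unfolding K_def using S(1) by (intro continuous_on_closed_Collect_le f_cont continuous_on_const)
  then have K: "compact K"
    using coercive by (simp add: compact_eq_bounded_closed K_def)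
  \<comment> \<open>The minimum over the compact sublevel set bounds the decreasing values from
    below, so they converge.\<close>
  obtain z0 where z0: "\<And>z. z \<in> K \<Longrightarrow> f z0 \<le> f z"
    using continuous_attains_inf[OF K _ continuous_on_subset[OF f_cont]] xK[of 0]
    by (auto simp: K_def)
  obtain v where v: "(\<lambda>k. f (x k)) \<longlonglongrightarrow> v"
    using decseq_convergent[OF \<open>decseq (\<lambda>k. f (x k))\<close>, of "f z0"] z0 xK by blast
  then have "(\<lambda>k. f (x k) - f (x (Suc k))) \<longlonglongrightarrow> 0"
    using tendsto_diff[OF v LIMSEQ_Suc[OF v]] by simp
  moreover have "norm (\<eta> * (a * (\<sigma> * (norm (d k))\<^sup>2))) \<le> f (x k) - f (x (Suc k))" for k
    using decrease[of k] eta a pos by (simp add: abs_mult)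
  ultimately have "(\<lambda>k. \<eta> * (a * (\<sigma> * (norm (d k))\<^sup>2))) \<longlonglongrightarrow> 0"
    by (rule Lim_null_comparison[OF always_eventually, OF allI, rotated])
  then have "(\<lambda>k. inverse (\<eta> * a * \<sigma>) * (\<eta> * (a * (\<sigma> * (norm (d k))\<^sup>2)))) \<longlonglongrightarrow> 0"
    by (rule tendsto_mult_right_zero)
  then have "(\<lambda>k. (norm (d k))\<^sup>2) \<longlonglongrightarrow> 0"
    using eta a pos by (simp add: mult.assoc[symmetric])
  then have "(\<lambda>k. sqrt ((norm (d k))\<^sup>2)) \<longlonglongrightarrow> sqrt 0"
    by (rule tendsto_real_sqrt)
  then have d0: "(\<lambda>k. norm (d k)) \<longlonglongrightarrow> 0" by simp
  \<comment> \<open>The inexactness is at most \<epsilon> k, so the exact minimizers approach the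
    iterates as well.\<close>
  have m_le: "norm (m k - x k) \<le> norm (d k) + \<epsilon> k" for k
    using near[of k] norm_triangle_ineq[of "xh k - x k" "m k - xh k"]
    by (simp add: d m_def norm_minus_commute)
  have "(\<lambda>k. norm (d k) + \<epsilon> k) \<longlonglongrightarrow> 0"
    using tendsto_add[OF d0 eps] by simp
  with m_le have m0: "(\<lambda>k. m k - x k) \<longlonglongrightarrow> 0"
    by (rule Lim_null_comparison[OF always_eventually, OF allI])

  have crit: "l \<in> S \<and> (\<forall>z\<in>S. 0 \<le> g l \<bullet> (z - l))" if r: "strict_mono r" "(x \<circ> r) \<longlonglongrightarrow> l" for r l
  proof -
    have l: "l \<in> S"
      using closed_sequentially[OF S(1) _ r(2)] xS by simp
    have gl: "(\<lambda>k. g (x (r k))) \<longlonglongrightarrow> g l"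
      using continuous_on_tendsto_compose[OF cont r(2) l] xS by (simp add: o_def)
    have xr: "(\<lambda>k. x (r k)) \<longlonglongrightarrow> l" using r(2) by (simp add: o_def)
    have mr: "(\<lambda>k. m (r k) - x (r k)) \<longlonglongrightarrow> 0"
      using LIMSEQ_subseq_LIMSEQ[OF m0 r(1)] by (simp add: o_def)
    have "0 \<le> g l \<bullet> (z - l)" if z: "z \<in> S" for z
    proof -
      have scaled: "0 \<le> t * (g l \<bullet> (z - l)) + \<Lambda> * (t\<^sup>2 * (norm (z - l))\<^sup>2)"
        if t: "0 < t" "t < 1" for t
      proof -
        have "g (x k) \<bullet> (m k - x k)
            \<le> t * (g (x k) \<bullet> (z - x k)) + \<Lambda> * (t\<^sup>2 * (norm (z - x k))\<^sup>2)" for k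
        proof -
          \<comment> \<open>Moving only the fraction t towards z gives a linear term of order t
            against a curvature term of order t^2.\<close>
          let ?z = "(1 - t) *\<^sub>R x k + t *\<^sub>R z"
          have zS: "?z \<in> S" using convexD_alt[OF S(2) xS z] t by simp
          have eq: "?z - x k = t *\<^sub>R (z - x k)" by (simp add: algebra_simps)
          have "0 \<le> \<sigma> * (norm (m k - x k))\<^sup>2" using pos by simp
          then have "M (x k) (x k) + g (x k) \<bullet> (m k - x k) \<le> M (x k) (m k)"
            using M_lower[OF xS[of k] m(1)[of k]] by linarith
          also have "\<dots> \<le> M (x k) ?z" by (rule m(2)[OF zS])
          also have "\<dots> \<le> M (x k) (x k) + t * (g (x k) \<bullet> (z - x k))
              + \<Lambda> * (t\<^sup>2 * (norm (z - x k))\<^sup>2)"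
            using M_upper[OF xS[of k] zS] unfolding eq by (simp add: power_mult_distrib)
          finally show ?thesis by simp
        qed
        \<comment> \<open>The left side vanishes in the limit, because minimizers and iterates merge
          while the gradients converge.\<close>
        moreover have "(\<lambda>k. g (x (r k)) \<bullet> (m (r k) - x (r k))) \<longlonglongrightarrow> g l \<bullet> 0"
          by (intro tendsto_intros gl mr)
        moreover have "(\<lambda>k. t * (g (x (r k)) \<bullet> (z - x (r k)))
              + \<Lambda> * (t\<^sup>2 * (norm (z - x (r k)))\<^sup>2))
            \<longlonglongrightarrow> t * (g l \<bullet> (z - l)) + \<Lambda> * (t\<^sup>2 * (norm (z - l))\<^sup>2)"
          by (intro tendsto_intros gl xr)
        ultimately have "g l \<bullet> 0 \<le> t * (g l \<bullet> (z - l)) + \<Lambda> * (t\<^sup>2 * (norm (z - l))\<^sup>2)"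
          by (meson LIMSEQ_le)
        then show ?thesis by simp
      qed
      \<comment> \<open>Division by t leaves one factor t in the curvature term, which disappears as
        t tends to 0 from the right.\<close>
      have "0 \<le> g l \<bullet> (z - l) + \<Lambda> * (t * (norm (z - l))\<^sup>2)" if t: "0 < t" "t < 1" for t
      proof -
        have "0 \<le> t * (g l \<bullet> (z - l) + \<Lambda> * (t * (norm (z - l))\<^sup>2))"
          using scaled[OF t] by (simp add: power2_eq_square algebra_simps)
        then show ?thesis using t by (simp add: zero_le_mult_iff)
      qed
      then have "\<forall>\<^sub>F t in at_right 0. 0 \<le> g l \<bullet> (z - l) + \<Lambda> * (t * (norm (z - l))\<^sup>2)"
        by (intro eventually_at_rightI[of 0 1]) auto
      moreover have "((\<lambda>t. g l \<bullet> (z - l) + \<Lambda> * (t * (norm (z - l))\<^sup>2))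
          \<longlongrightarrow> g l \<bullet> (z - l) + \<Lambda> * (0 * (norm (z - l))\<^sup>2)) (at_right 0)"
        by (intro tendsto_intros)
      ultimately have "0 \<le> g l \<bullet> (z - l) + \<Lambda> * (0 * (norm (z - l))\<^sup>2)"
        by (intro tendsto_lowerbound) auto
      then show ?thesis by simp
    qed
    with l show ?thesis by blast
  qed
  obtain l r where r: "strict_mono (r :: nat \<Rightarrow> nat)" "(x \<circ> r) \<longlonglongrightarrow> l"
    using seq_compactE[of K x] compact_imp_seq_compact[OF K] xK by metis
  note l = crit[OF r]
  have "x \<longlonglongrightarrow> l"
  proof (rule unique_limit_point_imp_LIMSEQ[OF K xK])
    fix r' l' assume "strict_mono r'" "(x \<circ> r') \<longlonglongrightarrow> l'"
    note l' = crit[OF this]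
    show "l' = l"
      using l l' by (intro critical_point_unique[OF S(3,2) strict, where g = g] lower) auto
  qed
  moreover have "projected_gradient S f l = 0"
    using l by (intro projected_gradient_eq_0[OF grad]) auto
  ultimately show ?thesis using l by blast
qed

section \<open>The Kullback-Leibler term\<close>

text \<open>One summand of \<open>KL\<close> as a function of the single number t = (A x + b)_j, so
  that bounds and derivatives become one-variable questions.\<close>

definition kl :: "real \<Rightarrow> real \<Rightarrow> real" where
  "kl y t = (if y = 0 then 0 else y * ln (y / t)) + t - y"

lemma kl_has_real_derivative:
  assumes "0 \<le> y" "0 < t"
  shows "(kl y has_real_derivative 1 - y / t) (at t)"
proof (cases "y = 0")
  case True
  then have "kl y = (\<lambda>t. t)" by (simp add: kl_def fun_eq_iff)
  then show ?thesis using True by simp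
next
  case False
  then have "((\<lambda>t. y * ln (y / t) + t - y) has_real_derivative 1 - y / t) (at t)"
    using assms by (auto intro!: derivative_eq_intros simp: field_simps power2_eq_square)
  moreover have "kl y = (\<lambda>t. y * ln (y / t) + t - y)"
    using False by (simp add: kl_def fun_eq_iff)
  ultimately show ?thesis by simp
qed

text \<open>Convexity in t, obtained from ln u \<le> u - 1 at u = t / s.\<close>

lemma kl_lower:
  assumes "0 \<le> y" "0 < s" "0 < t"
  shows "kl y s + (1 - y / s) * (t - s) \<le> kl y t"
proof (cases "y = 0")
  case False
  have "y * ln (t / s) \<le> y * (t / s - 1)"
    using assms by (intro mult_left_mono ln_le_minus_one) auto
  then show ?thesis
    using False assms by (simp add: kl_def ln_div field_simps)
qed (simp add: kl_def)

text \<open>Again ln u \<le> u - 1, now at u = s / t: the excess over the tangent is y (t - s)^2 /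
  (s t), and s t is at least c^2. The constant is twice what Taylor's formula would give.\<close>

lemma kl_upper:
  assumes "0 \<le> y" "0 < c" "c \<le> s" "c \<le> t"
  shows "kl y t \<le> kl y s + (1 - y / s) * (t - s) + y / c\<^sup>2 * (t - s)\<^sup>2"
proof (cases "y = 0")
  case False
  have pos: "0 < s" "0 < t" using assms by auto
  have "ln (s / t) \<le> s / t - 1"
    using pos by (intro ln_le_minus_one) auto
  also have "\<dots> = (t - s)\<^sup>2 / (s * t) - (t - s) / s"
    using pos by (simp add: field_simps power2_eq_square)
  also have "\<dots> \<le> (t - s)\<^sup>2 / c\<^sup>2 - (t - s) / s"
    using assms pos by (intro diff_right_mono divide_left_mono) (auto simp: power2_eq_square intro!: mult_mono)
  finally have "y * ln (s / t) \<le> y * ((t - s)\<^sup>2 / c\<^sup>2 - (t - s) / s)"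
    using assms by (intro mult_left_mono) auto
  then show ?thesis
    using False pos assms(1) by (simp add: kl_def ln_div algebra_simps)
qed (simp add: kl_def)

text \<open>The left side is the tangent line at t = 2 y, where the slope is 1/2. For y = 0 it is
  just t / 2 \<le> t.\<close>

lemma kl_linear_growth:
  assumes "0 \<le> y" "0 < t"
  shows "t / 2 + (kl y (2 * y) - y) \<le> kl y t"
proof (cases "y = 0")
  case False
  then show ?thesis
    using kl_lower[of y "2 * y" t] assms by (simp add: field_simps)
qed (use assms in \<open>simp add: kl_def\<close>)

definition KL_gradient :: "real ^ 'n ^ 'm \<Rightarrow> real ^ 'm \<Rightarrow> real ^ 'm \<Rightarrow> real ^ 'n \<Rightarrow> real ^ 'n" where
  "KL_gradient A b y x = (\<Sum>j\<in>UNIV. (1 - y $ j / (A *v x + b) $ j) *\<^sub>R A $ j)"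

lemma KL_eq_sum_kl: "KL A b y x = (\<Sum>j\<in>UNIV. kl (y $ j) ((A *v x + b) $ j))"
  unfolding KL_def kl_def by (rule refl)

lemma KL_gradient_inner:
  "KL_gradient A b y x \<bullet> (z - x) =
    (\<Sum>j\<in>UNIV. (1 - y $ j / (A *v x + b) $ j) * ((A *v z + b) $ j - (A *v x + b) $ j))"
  unfolding KL_gradient_def inner_sum_left
  by (intro sum.cong refl) (simp add: matrix_vector_mul_component inner_diff_right right_diff_distrib)

lemma KL_lower:
  assumes "\<And>j. 0 \<le> y $ j" "\<And>j. 0 < (A *v x + b) $ j" "\<And>j. 0 < (A *v z + b) $ j"
  shows "KL A b y x + KL_gradient A b y x \<bullet> (z - x) \<le> KL A b y z"
  unfolding KL_eq_sum_kl KL_gradient_inner sum.distrib[symmetric]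
  by (intro sum_mono kl_lower assms)

text \<open>On the orthant (A x + b)_j is at least b_j, which gives the factor y_j / b_j^2 through
  \<open>kl_upper\<close>; the squared row norms come from Cauchy-Schwarz.\<close>

definition KL_curvature :: "real ^ 'n ^ 'm \<Rightarrow> real ^ 'm \<Rightarrow> real ^ 'm \<Rightarrow> real" where
  "KL_curvature A b y = (\<Sum>j\<in>UNIV. y $ j / (b $ j)\<^sup>2 * (norm (A $ j))\<^sup>2)"

lemma KL_curvature_bound:
  assumes "\<And>j. 0 \<le> y $ j"
  shows "(\<Sum>j\<in>UNIV. y $ j / (b $ j)\<^sup>2 * (A $ j \<bullet> v)\<^sup>2) \<le> KL_curvature A b y * (norm v)\<^sup>2"
  unfolding KL_curvature_def sum_distrib_right mult.assoc power_mult_distrib[symmetric]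
  using assms Cauchy_Schwarz_ineq2[of _ v]
  by (intro sum_mono mult_left_mono) (simp_all add: abs_le_square_iff[symmetric])

lemma KL_upper:
  assumes "\<And>j. 0 \<le> y $ j" "\<And>j. 0 < b $ j"
    and "\<And>j. b $ j \<le> (A *v x + b) $ j" "\<And>j. b $ j \<le> (A *v z + b) $ j"
  shows "KL A b y z \<le> KL A b y x + KL_gradient A b y x \<bullet> (z - x)
    + KL_curvature A b y * (norm (z - x))\<^sup>2"
proof -
  have "KL A b y z \<le> (\<Sum>j\<in>UNIV. kl (y $ j) ((A *v x + b) $ j)
      + (1 - y $ j / (A *v x + b) $ j) * ((A *v z + b) $ j - (A *v x + b) $ j)
      + y $ j / (b $ j)\<^sup>2 * ((A *v z + b) $ j - (A *v x + b) $ j)\<^sup>2)"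
    unfolding KL_eq_sum_kl by (intro sum_mono kl_upper assms)
  also have "\<dots> = KL A b y x + KL_gradient A b y x \<bullet> (z - x)
      + (\<Sum>j\<in>UNIV. y $ j / (b $ j)\<^sup>2 * (A $ j \<bullet> (z - x))\<^sup>2)"
    unfolding KL_eq_sum_kl KL_gradient_inner sum.distrib
    by (simp add: matrix_vector_mul_component inner_diff_right)
  finally show ?thesis
    using KL_curvature_bound[OF assms(1), of b A "z - x"] by linarith
qed

section \<open>Gradient and Hessian of the Kullback-Leibler term\<close>

lemma row_has_derivative:
  fixes A :: "real ^ 'n ^ 'm"
  shows "((\<lambda>x. (A *v x + b) $ j) has_derivative (\<lambda>h. A $ j \<bullet> h)) (at x)"
  by (auto simp: matrix_vector_mul_component intro!: derivative_eq_intros)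

lemma KL_GDERIV:
  assumes "\<And>j. 0 \<le> y $ j" "\<And>j. 0 < (A *v x + b) $ j"
  shows "GDERIV (KL A b y) x :> KL_gradient A b y x"
proof -
  have "((\<lambda>x. \<Sum>j\<in>UNIV. kl (y $ j) ((A *v x + b) $ j)) has_derivative
      (\<lambda>h. \<Sum>j\<in>UNIV. (A $ j \<bullet> h) * (1 - y $ j / (A *v x + b) $ j))) (at x)"
    by (intro has_derivative_sum DERIV_compose_FDERIV row_has_derivative kl_has_real_derivative assms)
  moreover have "KL A b y = (\<lambda>x. \<Sum>j\<in>UNIV. kl (y $ j) ((A *v x + b) $ j))"
    by (simp add: KL_eq_sum_kl fun_eq_iff)
  ultimately show ?thesis
    by (simp add: gderiv_def KL_gradient_def inner_sum_right inner_commute mult.commute)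
qed

lemma KL_gradient_has_derivative:
  assumes "\<And>j. 0 < (A *v x + b) $ j"
  shows "(KL_gradient A b y has_derivative
    (\<lambda>h. \<Sum>j\<in>UNIV. ((A $ j \<bullet> h) * (y $ j / ((A *v x + b) $ j)\<^sup>2)) *\<^sub>R A $ j)) (at x)"
proof -
  have "((\<lambda>t. 1 - y $ j / t) has_real_derivative y $ j / ((A *v x + b) $ j)\<^sup>2) (at ((A *v x + b) $ j))" for j
    using assms[of j] by (auto intro!: derivative_eq_intros simp: power2_eq_square)
  then have "((\<lambda>x. \<Sum>j\<in>UNIV. (1 - y $ j / (A *v x + b) $ j) *\<^sub>R A $ j) has_derivative
    (\<lambda>h. \<Sum>j\<in>UNIV. ((A $ j \<bullet> h) * (y $ j / ((A *v x + b) $ j)\<^sup>2)) *\<^sub>R A $ j)) (at x)"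
    by (intro has_derivative_sum has_derivative_scaleR_left
        DERIV_compose_FDERIV[where g = "\<lambda>x. (A *v x + b) $ _"] row_has_derivative)
  moreover have "KL_gradient A b y = (\<lambda>x. \<Sum>j\<in>UNIV. (1 - y $ j / (A *v x + b) $ j) *\<^sub>R A $ j)"
    by (simp add: KL_gradient_def fun_eq_iff)
  ultimately show ?thesis by simp
qed

text \<open>The Hessian is A^T W A with W diagonal and entries y_j / (A x + b)_j^2.\<close>

lemma KL_hessian_quadratic_form:
  assumes "\<And>j. 0 \<le> y $ j" and x: "\<And>j. 0 < (A *v x + b) $ j"
  shows "v \<bullet> (hessian (KL A b y) x *v v)
    = (\<Sum>j\<in>UNIV. y $ j / ((A *v x + b) $ j)\<^sup>2 * (A $ j \<bullet> v)\<^sup>2)"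
proof -
  \<comment> \<open>The explicit gradient formula is known only where A x + b is positive. That set
    is open, so the derivative of the formula at x is also the derivative of
    \<open>gradient (KL A b y)\<close>.\<close>
  let ?U = "\<Inter>j. {x. 0 < (A *v x + b) $ j}"
  let ?H = "\<lambda>h. \<Sum>j\<in>UNIV. ((A $ j \<bullet> h) * (y $ j / ((A *v x + b) $ j)\<^sup>2)) *\<^sub>R A $ j"
  have "open {x. 0 < (A *v x + b) $ j}" for j
    by (simp add: matrix_vector_mul_component) (intro open_Collect_less continuous_intros)
  then have U: "open ?U" by (intro open_INT) auto
  have H: "(gradient (KL A b y) has_derivative ?H) (at x)"
    using KL_gradient_has_derivative[OF x] U
  proof (rule has_derivative_transform_within_open)
    show "KL_gradient A b y z = gradient (KL A b y) z" if "z \<in> ?U" for z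
      using that assms(1) by (intro gradient_eq[symmetric] KL_GDERIV) auto
  qed (use x in auto)
  have "hessian (KL A b y) x *v v = ?H v"
    unfolding hessian_def jacobian_def frechet_derivative_at[OF H, symmetric]
    using has_derivative_linear[OF H] by (simp add: matrix_works)
  then show ?thesis
    by (simp add: inner_sum_right power2_eq_square inner_commute mult_ac)
qed

section \<open>Growth of the Kullback-Leibler term and coercivity of its Hessian\<close>

lemma matrix_vector_ge_orthant:
  fixes A :: "real ^ 'n ^ 'm"
  assumes "\<And>i j. 0 \<le> A $ i $ j" "x \<in> nonneg_orthant"
  shows "b $ j \<le> (A *v x + b) $ j"
  using assms by (auto simp: matrix_vector_mult_def nonneg_orthant_def intro!: sum_nonneg)

text \<open>Since the columns sum to 1, the entries of A x add up to the l1 norm of x on the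
  orthant. This norm dominates the Euclidean one, and the scalar growth bounds can be summed over
  the rows.\<close>

lemma KL_linear_growth:
  assumes A: "\<And>i j. 0 \<le> A $ i $ j" "\<And>j. (\<Sum>i\<in>UNIV. A $ i $ j) = 1"
    and b: "\<And>j. 0 < b $ j" and y: "\<And>j. 0 \<le> y $ j" and x: "x \<in> nonneg_orthant"
  shows "norm x / 2 + (\<Sum>j\<in>UNIV. kl (y $ j) (2 * y $ j) - y $ j) \<le> KL A b y x"
proof -
  have pos: "0 < (A *v x + b) $ j" for j
    using matrix_vector_ge_orthant[OF A(1) x] b by (rule less_le_trans[rotated])
  have "norm x \<le> (\<Sum>i\<in>UNIV. x $ i)"
    using norm_le_l1_cart[of x] x by (simp add: nonneg_orthant_def)
  also have "\<dots> = (\<Sum>i\<in>UNIV. \<Sum>j\<in>UNIV. A $ j $ i * x $ i)"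
    by (simp add: sum_distrib_right[symmetric] A(2))
  also have "\<dots> = (\<Sum>j\<in>UNIV. (A *v x) $ j)"
    by (subst sum.swap) (simp add: matrix_vector_mult_def)
  also have "\<dots> \<le> (\<Sum>j\<in>UNIV. (A *v x + b) $ j)"
    using b by (intro sum_mono) (simp add: less_imp_le)
  finally have "norm x / 2 + (\<Sum>j\<in>UNIV. kl (y $ j) (2 * y $ j) - y $ j)
      \<le> (\<Sum>j\<in>UNIV. (A *v x + b) $ j) / 2 + (\<Sum>j\<in>UNIV. kl (y $ j) (2 * y $ j) - y $ j)"
    by simp
  also have "\<dots> = (\<Sum>j\<in>UNIV. (A *v x + b) $ j / 2 + (kl (y $ j) (2 * y $ j) - y $ j))"
    by (simp only: sum.distrib sum_divide_distrib)
  also have "\<dots> \<le> KL A b y x"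
    unfolding KL_eq_sum_kl by (intro sum_mono kl_linear_growth y pos)
  finally show ?thesis .
qed

text \<open>This serves the case \<gamma> = 0. Injectivity bounds |A v| below by B |v|, and on a
  bounded S the diagonal weights stay above Y / T^2.\<close>

lemma KL_hessian_coercive:
  fixes A :: "real ^ 'n ^ 'm"
  assumes y: "\<And>j. 0 < y $ j" and inj: "\<And>v. A *v v = 0 \<Longrightarrow> v = 0" and S: "bounded S"
    and pos: "\<And>c j. c \<in> S \<Longrightarrow> 0 < (A *v c + b) $ j"
  shows "\<exists>\<sigma>>0. \<forall>c\<in>S. \<forall>v.
    \<sigma> * (norm v)\<^sup>2 \<le> (\<Sum>j\<in>UNIV. y $ j / ((A *v c + b) $ j)\<^sup>2 * (A $ j \<bullet> v)\<^sup>2)"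
proof -
  have "inj ((*v) A)"
    by (metis inj matrix_vector_mul_linear linear_injective_0)
  then obtain B where B: "0 < B" "\<And>v. B * norm v \<le> norm (A *v v)"
    using linear_inj_bounded_below_pos[OF matrix_vector_mul_linear] by blast
  obtain R where R: "\<And>c. c \<in> S \<Longrightarrow> norm c \<le> R"
    using S by (auto simp: bounded_iff)
  \<comment> \<open>The maximum with 1 keeps T positive whatever R is.\<close>
  define T where "T = max 1 (onorm ((*v) A) * R + norm b)"
  define Y where "Y = Min (range (($) y))"
  have T: "0 < T" by (simp add: T_def)
  have Y: "0 < Y" "Y \<le> y $ j" for j
    using y by (auto simp: Y_def)
  have le_T: "(A *v c + b) $ j \<le> T" if "c \<in> S" for c j
  proof -
    have "(A *v c + b) $ j \<le> norm (A *v c + b)"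
      using component_le_norm_cart[of "A *v c + b" j] by linarith
    also have "\<dots> \<le> norm (A *v c) + norm b" by (rule norm_triangle_ineq)
    also have "norm (A *v c) \<le> onorm ((*v) A) * norm c"
      by (rule onorm[OF matrix_vector_mul_bounded_linear])
    also have "\<dots> \<le> onorm ((*v) A) * R"
      using R[OF that] by (intro mult_left_mono onorm_pos_le matrix_vector_mul_bounded_linear)
    finally show ?thesis by (simp add: T_def)
  qed
  show ?thesis
  proof (intro exI[of _ "Y / T\<^sup>2 * B\<^sup>2"] conjI ballI allI)
    show "0 < Y / T\<^sup>2 * B\<^sup>2" using Y T B by simp
    fix c v assume c: "c \<in> S"
    have "B\<^sup>2 * (norm v)\<^sup>2 \<le> (norm (A *v v))\<^sup>2"
      unfolding power_mult_distrib[symmetric] using B by (intro power_mono) auto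
    also have "\<dots> = (\<Sum>j\<in>UNIV. (A $ j \<bullet> v)\<^sup>2)"
      unfolding power2_norm_eq_inner inner_vec_def[of "A *v v" "A *v v"]
      by (simp add: matrix_vector_mul_component power2_eq_square)
    finally have "Y / T\<^sup>2 * (B\<^sup>2 * (norm v)\<^sup>2) \<le> Y / T\<^sup>2 * (\<Sum>j\<in>UNIV. (A $ j \<bullet> v)\<^sup>2)"
      using Y T by (intro mult_left_mono) (auto simp: less_imp_le)
    also have "\<dots> \<le> (\<Sum>j\<in>UNIV. y $ j / ((A *v c + b) $ j)\<^sup>2 * (A $ j \<bullet> v)\<^sup>2)"
      unfolding sum_distrib_left
      using Y pos[OF c] le_T[OF c] y
      by (intro sum_mono mult_right_mono frac_le power_mono zero_less_power)
        (auto simp: less_imp_le simp del: vector_add_component)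
    finally show "Y / T\<^sup>2 * B\<^sup>2 * (norm v)\<^sup>2
        \<le> (\<Sum>j\<in>UNIV. y $ j / ((A *v c + b) $ j)\<^sup>2 * (A $ j \<bullet> v)\<^sup>2)"
      by (simp add: mult.assoc)
  qed
qed

section \<open>The smoothed total variation\<close>

lemma huber_upper:
  fixes u v :: "'a::real_inner"
  assumes "0 < \<mu>"
  shows "huber \<mu> (norm u) \<le> huber \<mu> (norm v)
    + inverse (max \<mu> (norm v)) * (v \<bullet> (u - v)) + inverse \<mu> / 2 * (norm (u - v))\<^sup>2"
proof -
  (* As a function of the squared norm, the Huber function is concave; its tangent at v is
     the weighted quadratic of the model. *)
  let ?m = "max \<mu> (norm v)"
  have m: "0 < ?m" using assms by simp
  have "huber \<mu> (norm u) \<le> ((norm u)\<^sup>2 / ?m + ?m) / 2"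
  proof (cases "\<mu> < norm u")
    case True
    \<comment> \<open>The arithmetic-geometric mean inequality for the linear branch.\<close>
    have "0 \<le> (norm u - ?m)\<^sup>2" by simp
    then have "2 * ?m * norm u \<le> (norm u)\<^sup>2 + ?m\<^sup>2"
      by (simp add: power2_diff mult_ac)
    then show ?thesis
      using True m by (simp add: huber_def field_simps power2_eq_square)
  next
    case False
    \<comment> \<open>Up to the positive factor 2 m \<mu>, this product is the difference of the two
      sides in the quadratic branch.\<close>
    have "0 \<le> (?m - \<mu>) * (?m * \<mu> - (norm u)\<^sup>2)"
      using False assms m by (intro mult_nonneg_nonneg) (auto simp: power2_eq_square intro!: mult_mono)
    then show ?thesis
      using False m assms by (simp add: huber_def divide_simps) (simp add: algebra_simps)
  qed
  also have "\<dots> = huber \<mu> (norm v) + inverse ?m * (((norm u)\<^sup>2 - (norm v)\<^sup>2) / 2)"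
    using assms by (auto simp: huber_def max_def divide_simps power2_eq_square)
  also have "((norm u)\<^sup>2 - (norm v)\<^sup>2) / 2 = v \<bullet> (u - v) + (norm (u - v))\<^sup>2 / 2"
    by (simp add: power2_norm_eq_inner inner_diff_left inner_diff_right inner_commute field_simps)
  also have "inverse ?m * (v \<bullet> (u - v) + (norm (u - v))\<^sup>2 / 2)
      \<le> inverse ?m * (v \<bullet> (u - v)) + inverse \<mu> / 2 * (norm (u - v))\<^sup>2"
    using assms by (simp add: distrib_left mult_right_mono le_imp_inverse_le)
  finally show ?thesis by simp
qed

text \<open>By Cauchy-Schwarz the claim reduces to the norms a and c: the Huber function lies above
  its tangent at c, whose slope is c / m.\<close>

lemma huber_lower:
  fixes u v :: "'a::real_inner"
  assumes mu: "0 < \<mu>"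
  shows "huber \<mu> (norm v) + inverse (max \<mu> (norm v)) * (v \<bullet> (u - v)) \<le> huber \<mu> (norm u)"
proof -
  define a c m where "a = norm u" and "c = norm v" and "m = max \<mu> c"
  have nonneg: "0 \<le> a" "0 \<le> c" "0 < m" using mu by (auto simp: a_def c_def m_def)
  have "v \<bullet> (u - v) \<le> c * a - c\<^sup>2"
    using norm_cauchy_schwarz[of v u] by (simp add: a_def c_def inner_diff_right power2_norm_eq_inner)
  then have "inverse m * (v \<bullet> (u - v)) \<le> inverse m * (c * a - c\<^sup>2)"
    using nonneg by (intro mult_left_mono) auto
  moreover have "huber \<mu> c + inverse m * (c * a - c\<^sup>2) \<le> huber \<mu> a"
  proof (cases "\<mu> < c")
    case True
    \<comment> \<open>Here m = c and the tangent at c is the identity, so only a \<le>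
      \<open>huber \<mu> a\<close> is needed.\<close>
    have "0 \<le> (a - \<mu>)\<^sup>2" by simp
    then have "a \<le> huber \<mu> a"
      using mu by (auto simp: huber_def power2_eq_square field_simps)
    then show ?thesis
      using True mu by (simp add: m_def huber_def field_simps power2_eq_square)
  next
    case c: False
    show ?thesis
    proof (cases "\<mu> < a")
      case True
      \<comment> \<open>This product is 2 \<mu> times the gap between the two sides.\<close>
      have "0 \<le> (\<mu> - c) * (2 * a - \<mu> - c)" 
        using c True by (intro mult_nonneg_nonneg) auto
      then have "\<mu>\<^sup>2 + 2 * (c * a) \<le> c\<^sup>2 + 2 * (\<mu> * a)"
        by (simp add: algebra_simps power2_eq_square)
      then have "(\<mu>\<^sup>2 + 2 * (c * a - c\<^sup>2) + c\<^sup>2) / (2 * \<mu>) \<le> 2 * \<mu> * a / (2 * \<mu>)"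
        using mu by (intro divide_right_mono) auto
      then show ?thesis
        using c True mu nonneg(2) by (simp add: m_def huber_def divide_simps) (simp add: algebra_simps power2_eq_square)
    next
      case False
      have "0 \<le> (a - c)\<^sup>2 / (2 * \<mu>)" using mu by simp
      also have "\<dots> = huber \<mu> a - (huber \<mu> c + inverse m * (c * a - c\<^sup>2))"
        using c False mu nonneg
        by (simp add: m_def huber_def power2_diff divide_simps)
      finally show ?thesis by simp
    qed
  qed
  ultimately show ?thesis by (simp add: a_def c_def m_def)
qed

section \<open>Gradient, quadratic bounds and model of the total variation\<close>

definition TV_gradient :: "(nat \<Rightarrow> real ^ 'n ^ 2) \<Rightarrow> real \<Rightarrow> real ^ 'n \<Rightarrow> real ^ 'n" where
  "TV_gradient D \<mu> x = (\<Sum>i=1..CARD('n). TV_weight D \<mu> x i *\<^sub>R (transpose (D i) *v (D i *v x)))"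

text \<open>The weights never exceed 1 / \<mu>, so this one constant controls the quadratic terms of
  both the total variation and its model.\<close>

definition TV_curvature :: "(nat \<Rightarrow> real ^ 'n ^ 2) \<Rightarrow> real \<Rightarrow> real" where
  "TV_curvature D \<mu> = (\<Sum>i=1..CARD('n). inverse \<mu> / 2 * (onorm ((*v) (D i)))\<^sup>2)"

text \<open>In this form continuity in c and the bound 1 / \<mu> are visible without cases.\<close>

lemma TV_weight_eq: "TV_weight D \<mu> c i = inverse (max \<mu> (norm (D i *v c)))"
  by (simp add: TV_weight_def max_def)

lemma TV_gradient_inner:
  fixes D :: "nat \<Rightarrow> real ^ 'n ^ 2"
  shows "TV_gradient D \<mu> x \<bullet> v = (\<Sum>i=1..CARD('n). TV_weight D \<mu> x i * ((D i *v x) \<bullet> (D i *v v)))"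
  by (simp add: TV_gradient_def inner_sum_left dot_lmul_matrix)

lemma TV_curvature_bound:
  fixes D :: "nat \<Rightarrow> real ^ 'n ^ 2"
  assumes "0 < \<mu>"
  shows "(\<Sum>i=1..CARD('n). inverse \<mu> / 2 * (norm (D i *v v))\<^sup>2) \<le> TV_curvature D \<mu> * (norm v)\<^sup>2"
  unfolding TV_curvature_def sum_distrib_right mult.assoc power_mult_distrib[symmetric]
  using assms by (intro sum_mono mult_left_mono power_mono onorm matrix_vector_mul_bounded_linear) auto

lemma TV_lower:
  fixes D :: "nat \<Rightarrow> real ^ 'n ^ 2"
  assumes "0 < \<mu>"
  shows "TV D \<mu> x + TV_gradient D \<mu> x \<bullet> (z - x) \<le> TV D \<mu> z"
  unfolding TV_def TV_gradient_inner TV_weight_eq matrix_vector_mult_diff_distrib sum.distrib[symmetric]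
  by (intro sum_mono huber_lower assms)

lemma TV_upper:
  fixes D :: "nat \<Rightarrow> real ^ 'n ^ 2"
  assumes "0 < \<mu>"
  shows "TV D \<mu> z \<le> TV D \<mu> x + TV_gradient D \<mu> x \<bullet> (z - x) + TV_curvature D \<mu> * (norm (z - x))\<^sup>2"
proof -
  have "TV D \<mu> z \<le> TV D \<mu> x + TV_gradient D \<mu> x \<bullet> (z - x)
      + (\<Sum>i=1..CARD('n). inverse \<mu> / 2 * (norm (D i *v (z - x)))\<^sup>2)"
    unfolding TV_def TV_gradient_inner TV_weight_eq matrix_vector_mult_diff_distrib sum.distrib[symmetric]
    by (intro sum_mono huber_upper assms)
  then show ?thesis
    using TV_curvature_bound[OF assms, of D "z - x"] by linarith
qed

lemma continuous_on_TV_gradient: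
  assumes "0 < \<mu>"
  shows "continuous_on S (TV_gradient D \<mu>)"
  unfolding TV_gradient_def[abs_def] TV_weight_eq
  using assms
  by (intro continuous_intros continuous_on_compose2[of UNIV "(*v) _"] linear_continuous_on
      matrix_vector_mul_bounded_linear) auto

text \<open>The weights are frozen at c, so the expansion is exact, and its linear part is the
  gradient of \<open>TV\<close> itself at c.\<close>

lemma TV_model_expansion:
  fixes D :: "nat \<Rightarrow> real ^ 'n ^ 2"
  shows "TV_model D \<mu> c z = TV_model D \<mu> c c + TV_gradient D \<mu> c \<bullet> (z - c)
    + (\<Sum>i=1..CARD('n). TV_weight D \<mu> c i / 2 * (norm (D i *v (z - c)))\<^sup>2)"
proof -
  have "w / 2 * (norm (D i *v z))\<^sup>2 = w / 2 * (norm (D i *v c))\<^sup>2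
      + w * ((D i *v c) \<bullet> (D i *v (z - c))) + w / 2 * (norm (D i *v (z - c)))\<^sup>2" for i w
    by (simp add: matrix_vector_mult_diff_distrib power2_norm_eq_inner inner_diff_left inner_diff_right
        inner_commute field_simps)
  then have "(\<Sum>i=1..CARD('n). TV_weight D \<mu> c i / 2 * (norm (D i *v z))\<^sup>2) =
      (\<Sum>i=1..CARD('n). TV_weight D \<mu> c i / 2 * (norm (D i *v c))\<^sup>2)
      + TV_gradient D \<mu> c \<bullet> (z - c)
      + (\<Sum>i=1..CARD('n). TV_weight D \<mu> c i / 2 * (norm (D i *v (z - c)))\<^sup>2)"
    unfolding TV_gradient_inner sum.distrib[symmetric] by (intro sum.cong refl)
  then show ?thesis
    by (simp add: TV_model_def sum_distrib_left)
qed

section \<open>The objective and its models\<close>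

lemma objective_GDERIV:
  assumes "\<And>j. 0 \<le> y $ j" "\<And>j. 0 < (A *v x + b) $ j" "0 < \<mu>"
  shows "GDERIV (objective A b y D lam \<mu>) x :> KL_gradient A b y x + lam *\<^sub>R TV_gradient D \<mu> x"
proof -
  \<comment> \<open>Both bounds for \<open>TV\<close> hold on the whole space, as the sandwich
    criterion demands.\<close>
  have "GDERIV (TV D \<mu>) x :> TV_gradient D \<mu> x"
    by (rule GDERIV_quadratic_sandwich[OF TV_lower TV_upper]) (rule assms)+
  then have "((\<lambda>x. lam * TV D \<mu> x) has_derivative (\<lambda>h. lam * (h \<bullet> TV_gradient D \<mu> x))) (at x)"
    unfolding gderiv_def by (rule has_derivative_mult_right)
  from has_derivative_add[OF KL_GDERIV[OF assms(1,2), unfolded gderiv_def] this]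
  show ?thesis
    by (simp add: gderiv_def objective_def[abs_def] inner_add_right)
qed

text \<open>Model and objective share their gradient at the centre, so bounding the model above and
  below reduces to bounding the last two terms.\<close>

lemma quadratic_model_expansion:
  fixes A :: "real ^ 'n ^ 'm"
  assumes "\<And>j. 0 \<le> y $ j" "\<And>j. 0 < (A *v c + b) $ j"
  shows "quadratic_model A b y D lam \<mu> \<gamma> c z = quadratic_model A b y D lam \<mu> \<gamma> c c
    + (KL_gradient A b y c + lam *\<^sub>R TV_gradient D \<mu> c) \<bullet> (z - c)
    + ((\<Sum>j\<in>UNIV. y $ j / ((A *v c + b) $ j)\<^sup>2 * (A $ j \<bullet> (z - c))\<^sup>2) + \<gamma> * (norm (z - c))\<^sup>2) / 2
    + lam * (\<Sum>i=1..CARD('n). TV_weight D \<mu> c i / 2 * (norm (D i *v (z - c)))\<^sup>2)"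
proof -
  have "gradient (KL A b y) c = KL_gradient A b y c"
    by (rule gradient_eq[OF KL_GDERIV[OF assms]])
  moreover have "v \<bullet> ((hessian (KL A b y) c + \<gamma> *\<^sub>R mat 1) *v v)
      = (\<Sum>j\<in>UNIV. y $ j / ((A *v c + b) $ j)\<^sup>2 * (A $ j \<bullet> v)\<^sup>2) + \<gamma> * (norm v)\<^sup>2" for v
    unfolding KL_hessian_quadratic_form[OF assms, symmetric]
    by (simp add: matrix_vector_mult_add_rdistrib scaleR_matrix_vector_assoc[symmetric]
        inner_add_right power2_norm_eq_inner)
  ultimately show ?thesis
    unfolding quadratic_model_def KL_model_def TV_model_expansion[of D \<mu> c z]
    by (simp add: inner_add_left inner_add_right inner_commute distrib_left add_divide_distrib)
qed

theorem theorem4: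
  fixes A :: "real ^ 'n ^ 'm" and b y :: "real ^ 'm"
    and r s :: nat and \<iota> :: "nat \<Rightarrow> 'n"
    and X :: "real ^ 'n \<Rightarrow> nat \<Rightarrow> nat \<Rightarrow> real" and D :: "nat \<Rightarrow> real ^ 'n ^ 2"
    and S :: "(real ^ 'n) set"
    and lam \<mu> \<gamma> \<eta> \<delta> :: real and \<epsilon> :: "nat \<Rightarrow> real"
    and x :: "nat \<Rightarrow> real ^ 'n"
  assumes A_nonneg: "\<And>i j. 0 \<le> A $ i $ j"
    and A_columns: "\<And>j. (\<Sum>i\<in>UNIV. A $ i $ j) = 1"
    and b_pos: "\<And>j. 0 < b $ j"
    and y_nonneg: "\<And>j. 0 \<le> y $ j"
    and lam: "0 < lam" and mu: "0 < \<mu>"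
    and numbering: "bij_betw \<iota> {1..r * s} UNIV"
    and image: "extended_image r s \<iota> X"
    and differences: "difference_matrices r s X D"
    and S: "S \<noteq> {}" "closed S" "convex S" "S \<subseteq> nonneg_orthant"
    and gamma: "0 < \<gamma> \<or>
      (\<gamma> = 0 \<and> (\<forall>j. 0 < y $ j) \<and> (\<forall>v. A *v v = 0 \<longrightarrow> v = 0) \<and> bounded S)"
    and eta: "\<eta> \<in> {0<..<1}" and delta: "\<delta> \<in> {0<..<1}"
    and eps: "\<And>k. 0 < \<epsilon> k" "\<epsilon> \<longlonglongrightarrow> 0"
    and strict: "strictly_convex_on nonneg_orthant (objective A b y D lam \<mu>)"
    and seq: "acquire_sequence (objective A b y D lam \<mu>)
                (quadratic_model A b y D lam \<mu> \<gamma>) S \<eta> \<delta> \<epsilon> x"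
  shows "\<exists>xbar\<in>S. x \<longlonglongrightarrow> xbar \<and>
           projected_gradient S (objective A b y D lam \<mu>) xbar = 0"
proof -
  define g where "g x = KL_gradient A b y x + lam *\<^sub>R TV_gradient D \<mu> x" for x
  define L where "L = KL_curvature A b y + lam * TV_curvature D \<mu>"
  have ge_b: "b $ j \<le> (A *v c + b) $ j" if "c \<in> S" for c j
    using matrix_vector_ge_orthant[OF A_nonneg] that S(4) by blast
  have pos: "0 < (A *v c + b) $ j" if "c \<in> S" for c j
    using ge_b[OF that] b_pos by (rule less_le_trans[rotated])
  \<comment> \<open>Uniform strong convexity of the models comes from the shift \<gamma> when it is
    positive, and otherwise from the Hessian.\<close>
  obtain \<sigma> where sigma: "0 < \<sigma>" "\<And>c v. c \<in> S \<Longrightarrow> \<sigma> * (norm v)\<^sup>2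
      \<le> (\<Sum>j\<in>UNIV. y $ j / ((A *v c + b) $ j)\<^sup>2 * (A $ j \<bullet> v)\<^sup>2) + \<gamma> * (norm v)\<^sup>2"
  proof (cases "0 < \<gamma>")
    case True
    show thesis
    proof (rule that[OF True])
      fix c v
      have "0 \<le> (\<Sum>j\<in>UNIV. y $ j / ((A *v c + b) $ j)\<^sup>2 * (A $ j \<bullet> v)\<^sup>2)"
        using y_nonneg by (intro sum_nonneg) simp
      then show "\<gamma> * (norm v)\<^sup>2
          \<le> (\<Sum>j\<in>UNIV. y $ j / ((A *v c + b) $ j)\<^sup>2 * (A $ j \<bullet> v)\<^sup>2) + \<gamma> * (norm v)\<^sup>2"
        by simp
    qed
  next
    case False
    with gamma have zero: "\<gamma> = 0" "\<And>j. 0 < y $ j" "\<And>v. A *v v = 0 \<Longrightarrow> v = 0" "bounded S"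
      by auto
    obtain \<sigma> where "0 < \<sigma>" "\<And>c v. c \<in> S \<Longrightarrow>
        \<sigma> * (norm v)\<^sup>2 \<le> (\<Sum>j\<in>UNIV. y $ j / ((A *v c + b) $ j)\<^sup>2 * (A $ j \<bullet> v)\<^sup>2)"
      using KL_hessian_coercive[where S = S and b = b, OF zero(2-4) pos] by blast
    then show thesis
      using that zero(1) by simp
  qed
  show ?thesis
  \<comment> \<open>\<open>max 1 L\<close> is positive without further argument, and \<sigma> is
    halved because the model carries half its quadratic form.\<close>
  proof (rule acquire_sequence_converges[where g = g and L = "max 1 L" and \<sigma> = "\<sigma> / 2"
        and \<Lambda> = "\<bar>\<gamma>\<bar> + L", OF S(2-4) _ _ _ _ strict _ _ _ _ _ _ eta delta eps(2) seq])
    fix c assume c: "c \<in> S"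
    show "GDERIV (objective A b y D lam \<mu>) c :> g c"
      unfolding g_def by (rule objective_GDERIV[OF y_nonneg pos[OF c] mu])
    show "continuous_on S (quadratic_model A b y D lam \<mu> \<gamma> c)"
      unfolding quadratic_model_def[abs_def] KL_model_def TV_model_def
      by (intro continuous_intros continuous_on_compose2[of UNIV "(*v) _"] linear_continuous_on
          matrix_vector_mul_bounded_linear) auto
    fix z assume z: "z \<in> S"
    show "objective A b y D lam \<mu> c + g c \<bullet> (z - c) \<le> objective A b y D lam \<mu> z"
      using KL_lower[OF y_nonneg pos[OF c] pos[OF z]] mult_left_mono[OF TV_lower[OF mu, of D c z], of lam] lam
      by (simp add: objective_def g_def inner_add_left distrib_left)
    have "objective A b y D lam \<mu> z \<le> objective A b y D lam \<mu> c + g c \<bullet> (z - c) + L * (norm (z - c))\<^sup>2"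
      using KL_upper[OF y_nonneg b_pos ge_b[OF c] ge_b[OF z]]
        mult_left_mono[OF TV_upper[OF mu, of D z c], of lam] lam
      by (simp add: objective_def g_def L_def algebra_simps)
    also have "L * (norm (z - c))\<^sup>2 \<le> max 1 L * (norm (z - c))\<^sup>2"
      by (intro mult_right_mono) auto
    finally show "objective A b y D lam \<mu> z
        \<le> objective A b y D lam \<mu> c + g c \<bullet> (z - c) + max 1 L * (norm (z - c))\<^sup>2"
      by simp
    let ?M = "quadratic_model A b y D lam \<mu> \<gamma> c"
    define N q t where "N = (norm (z - c))\<^sup>2"
      and "q = (\<Sum>j\<in>UNIV. y $ j / ((A *v c + b) $ j)\<^sup>2 * (A $ j \<bullet> (z - c))\<^sup>2)"
      and "t = (\<Sum>i=1..CARD('n). TV_weight D \<mu> c i / 2 * (norm (D i *v (z - c)))\<^sup>2)"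
    have M: "?M z = ?M c + g c \<bullet> (z - c) + (q + \<gamma> * N) / 2 + lam * t"
      unfolding N_def q_def t_def g_def by (rule quadratic_model_expansion[OF y_nonneg pos[OF c]])
    have "0 \<le> t"
      unfolding t_def using mu by (intro sum_nonneg) (auto simp: TV_weight_eq)
    then have "0 \<le> lam * t" using lam by simp
    moreover have "\<sigma> * N \<le> q + \<gamma> * N"
      unfolding N_def q_def by (rule sigma(2)[OF c])
    ultimately have "?M c + g c \<bullet> (z - c) + \<sigma> / 2 * N \<le> ?M z"
      unfolding M by (simp add: add_divide_distrib)
    then show "?M c + g c \<bullet> (z - c) + \<sigma> / 2 * (norm (z - c))\<^sup>2 \<le> ?M z"
      by (simp only: N_def)
    have "t \<le> (\<Sum>i=1..CARD('n). inverse \<mu> / 2 * (norm (D i *v (z - c)))\<^sup>2)"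
      unfolding t_def using mu
      by (intro sum_mono mult_right_mono) (auto simp: TV_weight_eq intro!: le_imp_inverse_le)
    also have "\<dots> \<le> TV_curvature D \<mu> * N"
      unfolding N_def by (rule TV_curvature_bound[OF mu])
    finally have tv: "lam * t \<le> lam * (TV_curvature D \<mu> * N)"
      using lam by (intro mult_left_mono) auto
    \<comment> \<open>Replacing (A c + b)_j by b_j gives a bound that is the same for all
      centres.\<close>
    have "q \<le> (\<Sum>j\<in>UNIV. y $ j / (b $ j)\<^sup>2 * (A $ j \<bullet> (z - c))\<^sup>2)"
      unfolding q_def using y_nonneg b_pos ge_b[OF c] pos[OF c]
      by (intro sum_mono mult_right_mono frac_le power_mono zero_less_power)
        (auto simp: less_imp_le simp del: vector_add_component)
    also have "\<dots> \<le> KL_curvature A b y * N"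
      unfolding N_def by (rule KL_curvature_bound[OF y_nonneg])
    finally have kl: "q \<le> KL_curvature A b y * N" .
    \<comment> \<open>Nonnegativity of the bounds lets the factor 1/2 be dropped.\<close>
    have N: "0 \<le> N" by (simp add: N_def)
    then have "0 \<le> KL_curvature A b y * N"
      using y_nonneg by (auto simp: KL_curvature_def intro!: mult_nonneg_nonneg sum_nonneg)
    moreover have "\<gamma> * N \<le> \<bar>\<gamma>\<bar> * N" "0 \<le> \<bar>\<gamma>\<bar> * N"
      using N by (auto intro: mult_right_mono)
    moreover have "(\<bar>\<gamma>\<bar> + L) * N = \<bar>\<gamma>\<bar> * N + KL_curvature A b y * N + lam * (TV_curvature D \<mu> * N)"
      by (simp add: L_def algebra_simps)
    ultimately have "?M z \<le> ?M c + g c \<bullet> (z - c) + (\<bar>\<gamma>\<bar> + L) * N"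
      using tv kl unfolding M by (simp add: add_divide_distrib)
    then show "?M z \<le> ?M c + g c \<bullet> (z - c) + (\<bar>\<gamma>\<bar> + L) * (norm (z - c))\<^sup>2"
      by (simp only: N_def)
  next
    have "continuous_on S (KL_gradient A b y)"
      using KL_gradient_has_derivative[OF pos]
      by (meson continuous_at_imp_continuous_on has_derivative_continuous)
    then show "continuous_on S g"
      unfolding g_def by (intro continuous_intros continuous_on_TV_gradient mu)
  next
    fix c :: real
    define C where "C = (\<Sum>j\<in>UNIV. kl (y $ j) (2 * y $ j) - y $ j)"
    have "norm z \<le> 2 * (c - C)" if "z \<in> S" "objective A b y D lam \<mu> z \<le> c" for z
    proof -
      \<comment> \<open>Total variation is nonnegative, so a bound on the objective also bounds the
        Kullback-Leibler term, which grows at least linearly.\<close>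
      have "0 \<le> TV D \<mu> z"
        using mu by (auto simp: TV_def huber_def intro!: sum_nonneg)
      then have "KL A b y z \<le> c"
        using that(2) lam by (simp add: objective_def) (smt (verit) mult_nonneg_nonneg)
      moreover have "norm z / 2 + C \<le> KL A b y z"
        unfolding C_def using that(1) S(4) by (intro KL_linear_growth A_nonneg A_columns b_pos y_nonneg) auto
      ultimately show ?thesis by (simp add: field_simps)
    qed
    then show "bounded {z \<in> S. objective A b y D lam \<mu> z \<le> c}"
      unfolding bounded_iff by blast
  qed (use sigma(1) in simp_all)
qed

end
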